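(* Let $d\ge1$, let $u:\mathbb{Z}^d\to\mathbb{C}$ be compactly (i.e. finitely) supported, $\hat u=\mathcal{F}u$, and let $\lambda\in\mathbb{R}$ satisfy $2d-4<|\lambda|<2d$. Let $J$ be a positive integer and $k_1,\dots,k_J\in\Gamma(\lambda)$. Let $v=\mathcal{F}^{-1}\hat v$, where $$\hat v(p)=\hat u(p)\prod_{j=1}^J\big(\phi(p+k_j)-\lambda\big),\qquad p\in T^d.$$ Then $v$ is compactly supported on $\mathbb{Z}^d$, and the Born-approximation scattering amplitude $A=A(k,\omega)$ of $v$ at $\lambda$ vanishes identically in $\omega\in\mathbb{S}^{d-1}$ for each $k=k_j$, $j=1,\dots,J$.
   Context: $T^d=\mathbb{R}^d/2\pi\mathbb{Z}^d$, $\phi(k)=2\sum_{i=1}^d\cos k_i$, $\Gamma(\lambda)=\{k\in T^d:\phi(k)=\lambda\}$. For $2d-4<|\lambda|<2d$ and $\omega\in\mathbb{S}^{d-1}$, $\kappa(\omega,\lambda)$ denotes the unique point of $\Gamma(\lambda)$ with $\nabla\phi(\kappa)/|\nabla\phi(\kappa)|=\omega$. $K(\omega,\lambda)$ is the total curvature (product of principal curvatures, non-zero; the empty product $1$ if $d=1$) of $\Gamma(\lambda)$ at $\kappa(\omega,\lambda)$, and $\sigma=d-1$. Discrete Fourier transform: $\hat u(k)=\mathcal{F}u(k)=(2\pi)^{-d/2}\sum_{x\in\mathbb{Z}^d}u(x)e^{-ik\cdot x}$, $k\in T^d$, with inverse $\mathcal{F}^{-1}w(x)=(2\pi)^{-d/2}\int_{T^d}w(k)e^{ik\cdot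 x}\,dk$, $x\in\mathbb{Z}^d$. The discrete Schrödinger equation is $\Delta\psi+v\psi-\lambda\psi=0$ on $\mathbb{Z}^d$, with $\Delta\psi(x)=\sum_{|x'-x|=1}\psi(x')$. Its scattering amplitude in the Born approximation (for small $v$) is the function $$A(k,\omega)=-\frac{\sqrt{2\pi}\,\hat v\big(\kappa(-\omega,\lambda)-k\big)\,e^{-i(\sigma+2)\pi/4}}{\sqrt{|K(\omega,\lambda)|}\,|\nabla\phi(\kappa(\omega,\lambda))|},\qquad k\in\Gamma(\lambda),\ \omega\in\mathbb{S}^{d-1}.$$ In the statement, $A$ means this function. *)

theory Defs
  imports "HOL-Analysis.Analysis"
begin

definition torus_rel :: "real ^ 'n \<Rightarrow> real ^ 'n \<Rightarrow> bool" where
  "torus_rel k k' \<longleftrightarrow> (\<exists>m :: int ^ 'n. \<forall>i. k $ i - k' $ i = 2 * pi * of_int (m $ i))"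

lemma equivp_torus_rel: "equivp (torus_rel :: real ^ 'n \<Rightarrow> real ^ 'n \<Rightarrow> bool)"
proof (rule equivpI)
  show "reflp (torus_rel :: real ^ 'n \<Rightarrow> real ^ 'n \<Rightarrow> bool)"
    by (auto simp: reflp_def torus_rel_def intro!: exI[of _ 0])
  show "symp (torus_rel :: real ^ 'n \<Rightarrow> real ^ 'n \<Rightarrow> bool)"
  proof (rule sympI)
    fix a b :: "real ^ 'n"
    assume "torus_rel a b"
    then obtain m :: "int ^ 'n" where "\<And>i. a $ i - b $ i = 2 * pi * of_int (m $ i)"
      by (auto simp: torus_rel_def)
    then have "\<forall>i. b $ i - a $ i = 2 * pi * of_int ((- m) $ i)"
      by (simp add: algebra_simps)
    then show "torus_rel b a"
      unfolding torus_rel_def by blast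
  qed
  show "transp (torus_rel :: real ^ 'n \<Rightarrow> real ^ 'n \<Rightarrow> bool)"
  proof (rule transpI)
    fix a b c :: "real ^ 'n"
    assume "torus_rel a b" "torus_rel b c"
    then obtain m m' :: "int ^ 'n" where *:
      "\<And>i. a $ i - b $ i = 2 * pi * of_int (m $ i)"
      "\<And>i. b $ i - c $ i = 2 * pi * of_int (m' $ i)"
      by (auto simp: torus_rel_def)
    have "a $ i - c $ i = 2 * pi * of_int ((m + m') $ i)" for i
      using *(1)[of i] *(2)[of i] by (simp add: ring_distribs)
    then show "torus_rel a c"
      unfolding torus_rel_def by blast
  qed
qed

text \<open>The torus \<open>\<real>\<^sup>d / 2\<pi>\<int>\<^sup>d\<close> with \<open>d = CARD('n)\<close>, as an abelian group.\<close>

quotient_type 'n torus = "real ^ 'n" / "torus_rel :: real ^ 'n \<Rightarrow> real ^ 'n \<Rightarrow> bool"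
  morphisms torus_rep torus_of
  by (rule equivp_torus_rel)

instantiation torus :: (finite) ab_group_add
begin

lift_definition zero_torus :: "'a torus" is 0 .

lift_definition plus_torus :: "'a torus \<Rightarrow> 'a torus \<Rightarrow> 'a torus" is "(+)"
proof -
  fix a b c d :: "real ^ 'a"
  assume "torus_rel a b" "torus_rel c d"
  then obtain m m' :: "int ^ 'a" where *:
    "\<And>i. a $ i - b $ i = 2 * pi * of_int (m $ i)"
    "\<And>i. c $ i - d $ i = 2 * pi * of_int (m' $ i)"
    by (auto simp: torus_rel_def)
  have "(a + c) $ i - (b + d) $ i = 2 * pi * of_int ((m + m') $ i)" for i
    using *(1)[of i] *(2)[of i] by (simp add: ring_distribs)
  then show "torus_rel (a + c) (b + d)"
    unfolding torus_rel_def by blast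
qed

lift_definition uminus_torus :: "'a torus \<Rightarrow> 'a torus" is uminus
proof -
  fix a b :: "real ^ 'a"
  assume "torus_rel a b"
  then obtain m :: "int ^ 'a" where *: "\<And>i. a $ i - b $ i = 2 * pi * of_int (m $ i)"
    by (auto simp: torus_rel_def)
  have "(- a) $ i - (- b) $ i = 2 * pi * of_int ((- m) $ i)" for i
    using *[of i] by simp
  then show "torus_rel (- a) (- b)"
    unfolding torus_rel_def by blast
qed

definition minus_torus :: "'a torus \<Rightarrow> 'a torus \<Rightarrow> 'a torus" where
  "minus_torus p q = p + (- q)"

instance
proof
  fix a b c :: "'a torus"
  note refl = equivp_reflp[OF equivp_torus_rel]
  show "a + b + c = a + (b + c)" by transfer (simp add: add.assoc refl)
  show "a + b = b + a" by transfer (simp add: add.commute refl)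
  show "0 + a = a" by transfer (simp add: refl)
  show "- a + a = 0" by transfer (simp add: refl)
  show "a - b = a + - b" by (simp add: minus_torus_def)
qed

end

text \<open>The dispersion relation \<open>\<phi>(k) = 2 \<Sum>\<^sub>i cos k\<^sub>i\<close>, and the characters \<open>k \<mapsto> exp(i k\<cdot>x)\<close>,
  \<open>x \<in> \<int>\<^sup>d\<close>, as functions on the torus.\<close>

lift_definition \<phi> :: "'n::finite torus \<Rightarrow> real" is "\<lambda>k. 2 * (\<Sum>i\<in>UNIV. cos (k $ i))"
proof -
  fix a b :: "real ^ 'n"
  assume "torus_rel a b"
  then obtain m :: "int ^ 'n" where *: "\<And>i. a $ i - b $ i = 2 * pi * of_int (m $ i)"
    by (auto simp: torus_rel_def)
  have "cos (a $ i) = cos (b $ i)" for i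
  proof -
    have "a $ i = b $ i + 2 * pi * of_int (m $ i)"
      using *[of i] by simp
    moreover have "sin (2 * pi * of_int (m $ i)) = 0" "cos (2 * pi * of_int (m $ i)) = 1"
      by simp_all
    ultimately show ?thesis
      by (metis cos_add mult.right_neutral mult_zero_right diff_zero)
  qed
  then show "2 * (\<Sum>i\<in>UNIV. cos (a $ i)) = 2 * (\<Sum>i\<in>UNIV. cos (b $ i))"
    by simp
qed

lift_definition torus_char :: "int ^ 'n \<Rightarrow> 'n::finite torus \<Rightarrow> complex" is
  "\<lambda>x k. exp (\<i> * of_real (\<Sum>i\<in>UNIV. k $ i * of_int (x $ i)))"
proof -
  fix x :: "int ^ 'n" and a b :: "real ^ 'n"
  assume "torus_rel a b"
  then obtain m :: "int ^ 'n" where *: "\<And>i. a $ i - b $ i = 2 * pi * of_int (m $ i)"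
    by (auto simp: torus_rel_def)
  define M where "M = (\<Sum>i\<in>UNIV. m $ i * x $ i)"
  have "a $ i = b $ i + 2 * pi * of_int (m $ i)" for i
    using *[of i] by simp
  then have "(\<Sum>i\<in>UNIV. a $ i * of_int (x $ i))
      = (\<Sum>i\<in>UNIV. b $ i * of_int (x $ i)) + 2 * pi * of_int M"
    by (simp add: M_def ring_distribs sum.distrib sum_distrib_left mult.assoc)
  then have "cis (\<Sum>i\<in>UNIV. a $ i * of_int (x $ i)) = cis (\<Sum>i\<in>UNIV. b $ i * of_int (x $ i))"
    by (simp add: cis_mult[symmetric] cis_multiple_2pi)
  then show "exp (\<i> * of_real (\<Sum>i\<in>UNIV. a $ i * of_int (x $ i)))
      = exp (\<i> * of_real (\<Sum>i\<in>UNIV. b $ i * of_int (x $ i)))"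
    by (simp only: cis_conv_exp)
qed

text \<open>The integral over the torus is taken over the fundamental domain \<open>[-\<pi>,\<pi>]\<^sup>d\<close>.\<close>

definition torus_integral :: "('n::finite torus \<Rightarrow> complex) \<Rightarrow> complex" where
  "torus_integral w =
    (LINT y : cbox (\<chi> i. - pi) (\<chi> i. pi) | lborel. w (torus_of (y :: real ^ 'n)))"

definition fourier :: "(int ^ 'n::finite \<Rightarrow> complex) \<Rightarrow> 'n torus \<Rightarrow> complex" where
  "fourier u k =
    of_real ((2 * pi) powr (- real CARD('n) / 2)) * (\<Sum>\<^sub>\<infinity>x\<in>UNIV. u x * torus_char (- x) k)"

definition inverse_fourier :: "('n::finite torus \<Rightarrow> complex) \<Rightarrow> int ^ 'n \<Rightarrow> complex" where
  "inverse_fourier w x =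
    of_real ((2 * pi) powr (- real CARD('n) / 2)) * torus_integral (\<lambda>k. w k * torus_char x k)"

definition level_set :: "real \<Rightarrow> 'n::finite torus set" (\<open>\<Gamma>\<close>) where
  "\<Gamma> lam = {k. \<phi> k = lam}"

text \<open>Tangent spaces of the torus are identified with \<open>\<real>\<^sup>d\<close> through the charts
  \<open>x \<mapsto> p + torus_of x\<close> centred at \<open>p\<close>.\<close>

definition torus_grad :: "('n::finite torus \<Rightarrow> real) \<Rightarrow> 'n torus \<Rightarrow> real ^ 'n" where
  "torus_grad f p = (THE g. GDERIV (\<lambda>x. f (p + torus_of x)) 0 :> g)"

definition unit_normal :: "('n::finite torus \<Rightarrow> real) \<Rightarrow> 'n torus \<Rightarrow> real ^ 'n" where
  "unit_normal f p = torus_grad f p /\<^sub>R norm (torus_grad f p)"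

text \<open>Geometry at \<open>p\<close> of the level set of \<open>f\<close> through \<open>p\<close>, at points where the gradient does not
  vanish.  The field \<open>unit_normal f\<close> is normal to all nearby level sets, so its derivative restricted
  to the tangent space at \<open>p\<close> is the shape operator, up to a sign convention to which the absolute
  value taken in the amplitude is insensitive.  The total curvature is the product of the principal
  curvatures, repeated according to multiplicity; for \<open>d = 1\<close> the tangent space is trivial and this
  is the empty product.\<close>

definition tangent_space :: "('n::finite torus \<Rightarrow> real) \<Rightarrow> 'n torus \<Rightarrow> (real ^ 'n) set" where
  "tangent_space f p = {\<xi>. torus_grad f p \<bullet> \<xi> = 0}"

definition shape_operator :: "('n::finite torus \<Rightarrow> real) \<Rightarrow> 'n torus \<Rightarrow> real ^ 'n \<Rightarrow> real ^ 'n" where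
  "shape_operator f p = frechet_derivative (\<lambda>x. unit_normal f (p + torus_of x)) (at 0)"

definition curvature_space :: "('n::finite torus \<Rightarrow> real) \<Rightarrow> 'n torus \<Rightarrow> real \<Rightarrow> (real ^ 'n) set" where
  "curvature_space f p \<mu> = {\<xi> \<in> tangent_space f p. shape_operator f p \<xi> = \<mu> *\<^sub>R \<xi>}"

definition principal_curvatures :: "('n::finite torus \<Rightarrow> real) \<Rightarrow> 'n torus \<Rightarrow> real set" where
  "principal_curvatures f p = {\<mu>. \<exists>\<xi> \<in> curvature_space f p \<mu>. \<xi> \<noteq> 0}"

definition total_curvature :: "('n::finite torus \<Rightarrow> real) \<Rightarrow> 'n torus \<Rightarrow> real" where
  "total_curvature f p = (\<Prod>\<mu>\<in>principal_curvatures f p. \<mu> ^ dim (curvature_space f p \<mu>))"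

text \<open>For \<open>2d - 4 < \<bar>lam\<bar> < 2d\<close> and \<open>\<bar>\<omega>\<bar> = 1\<close> the point described exists and is unique.\<close>

definition \<kappa> :: "real ^ 'n::finite \<Rightarrow> real \<Rightarrow> 'n torus" where
  "\<kappa> \<omega> lam = (THE k. k \<in> \<Gamma> lam \<and> unit_normal \<phi> k = \<omega>)"

text \<open>The scattering amplitude at energy \<open>lam\<close> in the Born approximation, for the discrete
  Schroedinger equation with potential \<open>v\<close>; here \<open>k \<in> \<Gamma> lam\<close> and \<open>\<omega>\<close> is a unit vector.
  The exponent contains \<open>\<sigma> = d - 1\<close>.\<close>

definition born_amplitude ::
    "(int ^ 'n::finite \<Rightarrow> complex) \<Rightarrow> real \<Rightarrow> 'n torus \<Rightarrow> real ^ 'n \<Rightarrow> complex" where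
  "born_amplitude v lam k \<omega> =
    - (of_real (sqrt (2 * pi)) * fourier v (\<kappa> (- \<omega>) lam - k)
        * exp (- \<i> * of_real ((real (CARD('n) - 1) + 2) * pi / 4)))
      / of_real (sqrt \<bar>total_curvature \<phi> (\<kappa> \<omega> lam)\<bar>
          * norm (torus_grad \<phi> (\<kappa> \<omega> lam)))"

end

theory Submission
  imports Defs
begin

text \<open>
  The Born amplitude at \<open>(k, \<omega>)\<close> is a multiple of the Fourier transform of \<open>v\<close> at \<open>\<kappa>(-\<omega>, \<lambda>) - k\<close>.
  At \<open>p = \<kappa>(-\<omega>, \<lambda>) - k\<^sub>j\<close> the \<open>j\<close>-th factor of the prescribed transform is
  \<open>\<phi>(\<kappa>(-\<omega>, \<lambda>)) - \<lambda>\<close>, which vanishes because \<open>\<kappa>(-\<omega>, \<lambda>)\<close> lies on the level set. Two facts have to be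
  supplied to make this a proof.

  First, \<open>v\<close> is defined as an inverse transform, so it must be checked that its transform is the
  prescribed function. That function is a trigonometric polynomial: the transform of a finitely
  supported \<open>u\<close> is one, \<open>\<phi>\<close> is one, and they form an algebra closed under translation. For
  trigonometric polynomials, orthogonality of the characters gives both finite support of the
  inverse transform and Fourier inversion (\<open>fourier_inversion_trig_poly\<close>).

  Second, \<open>\<kappa>(\<omega>, \<lambda>)\<close> must exist and be unique (\<open>\<kappa>_in_level_set\<close>). The gradient of \<open>\<phi>\<close> is
  \<open>(- 2 sin k\<^sub>i)\<close>, so a point with unit normal \<open>\<omega>\<close> has \<open>sin k\<^sub>i = - s \<omega>\<^sub>i\<close> for some \<open>s > 0\<close>, and the
  question is whether the signs of the cosines and the number \<open>s\<close> are determined by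
  \<open>\<Sum> cos k\<^sub>i = \<lambda>/2\<close>. The condition \<open>2d - 4 < \<bar>\<lambda>\<bar> < 2d\<close> allows at most one cosine to have the
  sign opposite to \<open>\<lambda>\<close>; existence is the intermediate value theorem along the path that moves
  this one cosine through zero (\<open>normal_ray_cosines_exist\<close>), and uniqueness is an elementary
  inequality expressing the convexity of the level set (\<open>normal_ray_cosines_unique\<close>).
\<close>

section \<open>Cosine vectors along a normal ray\<close>

text \<open>Two points of the level set with the same unit normal \<open>\<omega>\<close> have cosine vectors \<open>x\<close>, \<open>y\<close> as below,
  with \<open>w i = \<omega>\<^sub>i\<^sup>2\<close> and with \<open>a\<close>, \<open>b\<close> the squared proportionality factors between sine vector and
  normal. Since \<open>x i \<le> 1\<close>, a sum above \<open>d - 2\<close> forces the sum of any two distinct entries to be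
  positive, so at most one entry of \<open>x\<close> is negative.

  If none is, then \<open>x\<close> dominates \<open>y\<close> entrywise, and equal sums give equality. If \<open>x m = - c < 0\<close>,
  then \<open>w m\<close> is the largest weight. Passing from \<open>a\<close> to a larger \<open>b\<close> lowers the entries \<open>i \<noteq> m\<close> and
  raises the entry \<open>m\<close>, and the raise wins: the lowering at \<open>i\<close> is \<open>1 - x i\<close> times a factor that is
  at most the corresponding factor at \<open>m\<close>, where \<open>1 - x i\<close> is replaced by \<open>1 - c\<close>; and the sum
  being above \<open>d - 2\<close> says that the numbers \<open>1 - x i\<close>, \<open>i \<noteq> m\<close>, add up to less than \<open>1 - c\<close>.
  This is a derivative-free form of the strict convexity of the level set.\<close>

lemma normal_ray_cosines_unique_le:
  fixes x y w :: "'n::finite \<Rightarrow> real"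
  assumes a: "0 < a" "a \<le> b" and w: "\<And>i. 0 \<le> w i"
    and x: "\<And>i. (x i)\<^sup>2 + a * w i = 1" and y: "\<And>i. (y i)\<^sup>2 + b * w i = 1"
    and sum_eq: "sum x UNIV = sum y UNIV" and large: "real CARD('n) - 2 < sum x UNIV"
  shows "x = y"
proof -
  have le1: "z \<le> 1" "-1 \<le> z" if "z\<^sup>2 + c * w i = 1" "c > 0" for z c i
  proof -
    have "z\<^sup>2 \<le> 1" using that w[of i] by (metis le_add_same_cancel1 mult_nonneg_nonneg less_imp_le)
    then show "z \<le> 1" "-1 \<le> z" by (simp_all add: abs_square_le_1 abs_le_iff)
  qed
  have x1: "x i \<le> 1" and y1: "y i \<le> 1" "-1 \<le> y i" for i
    using le1[OF x] le1[OF y] a by auto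
  have pair: "0 < z i + z j"
    if "\<And>i. z i \<le> 1" "real CARD('n) - 2 < sum z UNIV" "i \<noteq> j" for z :: "'n \<Rightarrow> real" and i j
  proof -
    have "sum z (UNIV - {i,j}) \<le> (\<Sum>_\<in>UNIV - {i,j}. 1)"
      using that by (intro sum_mono) auto
    also have "\<dots> = real CARD('n) - 2"
    proof -
      have "card {i,j} \<le> CARD('n)" by (rule card_mono) auto
      then show ?thesis using that by (simp add: card_Diff_subset of_nat_diff)
    qed
    finally have "sum z (UNIV - {i,j}) \<le> real CARD('n) - 2" .
    moreover have "sum z UNIV = sum z (UNIV - {i,j}) + sum z {i,j}"
      by (rule sum.subset_diff) auto
    ultimately show ?thesis using that by simp
  qed
  have sq_diff: "(x i)\<^sup>2 - (y i)\<^sup>2 = (b - a) * w i" for i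
    using x[of i] y[of i] by (simp add: algebra_simps)
  show ?thesis
  proof (cases "\<forall>i. 0 \<le> x i")
    case True
    have "y i \<le> x i" for i
    proof (rule power2_le_imp_le)
      have "0 \<le> (b - a) * w i" using a w by simp
      then show "(y i)\<^sup>2 \<le> (x i)\<^sup>2" using sq_diff[of i] by linarith
    qed (use True in auto)
    then have "x i = y i" for i
      using sum_eq sum_mono_inv[of y UNIV x i] by auto
    then show ?thesis by auto
  next
    case False
    then obtain m where m: "x m < 0" by (auto simp: not_le)
    define c p where "c = - x m" and "p = \<bar>y m\<bar>"
    have c: "0 < c" and p: "0 \<le> p" "p \<le> 1" using m y1[of m] by (auto simp: c_def p_def)
    have sum_split: "sum z UNIV = z m + sum z (UNIV - {m})" for z :: "'n \<Rightarrow> real"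
      by (rule sum.remove) auto
    have xc: "c < x i" if "i \<noteq> m" for i
      using pair[of x i m] x1 large that by (simp add: c_def)
    have ym: "p \<le> y i" "0 < y i" if "i \<noteq> m" for i
    proof -
      have "(x m)\<^sup>2 \<le> (x i)\<^sup>2" using power_mono[of c "x i" 2] xc[OF that] c by (simp add: c_def)
      then have "a * w i \<le> a * w m" using x[of i] x[of m] by linarith
      then have "w i \<le> w m" using a by simp
      then have "b * w i \<le> b * w m" using a by (simp add: mult_left_mono)
      then have "(y m)\<^sup>2 \<le> (y i)\<^sup>2" using y[of i] y[of m] by linarith
      then have 1: "p \<le> \<bar>y i\<bar>" by (simp add: p_def abs_le_square_iff)
      moreover have "0 < y i + y m" using pair[of y i m] y1 large sum_eq that by simp
      ultimately show "p \<le> y i" "0 < y i" by (auto simp: p_def)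
    qed
    have rest: "(\<Sum>i\<in>UNIV - {m}. x i - y i) = c + y m"
      using sum_eq sum_split[of x] sum_split[of y] by (simp add: c_def sum_subtractf)
    have gap: "(\<Sum>i\<in>UNIV - {m}. 1 - x i) < 1 - c"
    proof -
      have "1 \<le> CARD('n)" by (simp add: Suc_leI)
      then show ?thesis using large sum_split[of x]
        by (simp add: c_def sum_subtractf card_Diff_subset of_nat_diff)
    qed
    show ?thesis
    proof (cases "a = b")
      case True
      have eq: "x i = y i" if "i \<noteq> m" for i
        using sq_diff[of i] True ym[OF that] xc[OF that] c by (simp add: power2_eq_iff)
      then have "c + y m = 0" using rest by simp
      then have "x m = y m" by (simp add: c_def)
      with eq show ?thesis by (metis ext)
    next
      case False
      then have D: "0 < b - a" using a by simp
      \<comment> \<open>Up to the factor \<open>a\<close>, the rise at \<open>m\<close> is at least \<open>r * (1 - c)\<close> and the fall at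
        \<open>i \<noteq> m\<close> at most \<open>r * (1 - x i)\<close>.\<close>
      define r where "r = (b - a) * (1 + c) / (c + p)"
      have r: "0 < r" using D c p by (simp add: r_def)
      have term_le: "a * (x i - y i) \<le> r * (1 - x i)" if "i \<noteq> m" for i
      proof -
        have pos: "0 < x i + y i" "0 < c + p" using xc[OF that] ym[OF that] c p by auto
        \<comment> \<open>The function \<open>(1 + x) / (x + y)\<close> decreases in \<open>x\<close> (as \<open>y \<le> 1\<close>) and in \<open>y\<close>, while
          \<open>c \<le> x i\<close> and \<open>p \<le> y i\<close>.\<close>
        have "(1 + x i) * (c + p) \<le> (1 + c) * (x i + y i)"
        proof -
          have "0 \<le> (x i - c) * (1 - p)" using xc[OF that] p by simp
          moreover have "0 \<le> (1 + c) * (y i - p)" using ym[OF that] c by simp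
          ultimately show ?thesis by (simp add: algebra_simps)
        qed
        then have "(1 + x i) / (x i + y i) \<le> (1 + c) / (c + p)"
          using pos by (simp add: divide_simps)
        then have "((b - a) * (1 - x i)) * ((1 + x i) / (x i + y i)) \<le> ((b - a) * (1 - x i)) * ((1 + c) / (c + p))"
          using D x1[of i] by (intro mult_left_mono) auto
        moreover have "a * (x i - y i) = ((b - a) * (1 - x i)) * ((1 + x i) / (x i + y i))"
        proof -
          have "a * (x i - y i) * (x i + y i) = a * ((x i)\<^sup>2 - (y i)\<^sup>2)"
            by (simp add: power2_eq_square algebra_simps)
          also have "\<dots> = (b - a) * (a * w i)"
            unfolding sq_diff by simp
          also have "a * w i = 1 - (x i)\<^sup>2"
            using x[of i] by simp
          also have "(b - a) * (1 - (x i)\<^sup>2) = (b - a) * (1 - x i) * (1 + x i)"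
            by (simp add: power2_eq_square algebra_simps)
          finally show ?thesis using pos by (simp add: field_simps)
        qed
        ultimately show ?thesis by (simp add: r_def mult_ac)
      qed
      have "a * (c + y m) = (\<Sum>i\<in>UNIV - {m}. a * (x i - y i))"
        using rest by (simp add: sum_distrib_left[symmetric])
      also have "\<dots> \<le> (\<Sum>i\<in>UNIV - {m}. r * (1 - x i))"
        by (rule sum_mono) (use term_le in auto)
      also have "\<dots> = r * (\<Sum>i\<in>UNIV - {m}. 1 - x i)"
        by (simp add: sum_distrib_left)
      also have "\<dots> < r * (1 - c)" using gap r by simp
      also have "\<dots> = a * (c - p)"
      proof -
        have "a * (c - p) * (c + p) = a * ((x m)\<^sup>2 - (y m)\<^sup>2)"
          by (simp add: c_def p_def algebra_simps power2_eq_square[symmetric])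
        also have "\<dots> = (b - a) * (a * w m)"
          unfolding sq_diff by simp
        also have "a * w m = 1 - (x m)\<^sup>2"
          using x[of m] by simp
        also have "(b - a) * (1 - (x m)\<^sup>2) = (b - a) * (1 + c) * (1 - c)"
          by (simp add: c_def power2_eq_square algebra_simps)
        finally show ?thesis using c p by (simp add: r_def field_simps)
      qed
      also have "\<dots> \<le> a * (c + y m)" using a by (simp add: p_def)
      finally show ?thesis by simp
    qed
  qed
qed

text \<open>A negative level reduces to a positive one by the half-period shift \<open>k\<^sub>i \<mapsto> k\<^sub>i + \<pi>\<close>,
  which changes the sign of every cosine.\<close>

lemma normal_ray_cosines_unique:
  fixes x y w :: "'n::finite \<Rightarrow> real"
  assumes a: "0 < a" "0 < b" and w: "\<And>i. 0 \<le> w i"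
    and x: "\<And>i. (x i)\<^sup>2 + a * w i = 1" and y: "\<And>i. (y i)\<^sup>2 + b * w i = 1"
    and sums: "sum x UNIV = \<mu>" "sum y UNIV = \<mu>" and large: "real CARD('n) - 2 < \<bar>\<mu>\<bar>"
  shows "x = y"
proof -
  have *: "x = y" if "real CARD('n) - 2 < \<mu>" "0 < a" "0 < b" "sum x UNIV = \<mu>" "sum y UNIV = \<mu>"
    "\<And>i. (x i)\<^sup>2 + a * w i = 1" "\<And>i. (y i)\<^sup>2 + b * w i = 1"
    for x y :: "'n \<Rightarrow> real" and a b \<mu>
  proof (cases "a \<le> b")
    case True
    then show ?thesis using that w by (intro normal_ray_cosines_unique_le[of a b w]) auto
  next
    case False
    then have "y = x" using that w by (intro normal_ray_cosines_unique_le[of b a w]) auto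
    then show ?thesis ..
  qed
  show ?thesis
  proof (cases "0 \<le> \<mu>")
    case True
    then show ?thesis using * assms by simp
  next
    case False
    then have "(\<lambda>i. - x i) = (\<lambda>i. - y i)"
      using assms by (intro *[where \<mu> = "- \<mu>" and a = a and b = b]) (auto simp: sum_negf)
    then show ?thesis by (auto simp: fun_eq_iff)
  qed
qed

text \<open>Let the cosine at an index \<open>m\<close> of maximal \<open>\<bar>\<omega> m\<bar>\<close> run through \<open>cos \<theta>\<close>, \<open>0 \<le> \<theta> \<le> \<pi>\<close>. It then
  passes smoothly from the positive to the negative branch of the square root, while all other
  cosines can stay on the positive branch. Their sum moves continuously from \<open>d\<close> to \<open>d - 2\<close>.\<close>

lemma normal_ray_cosines_exist:
  fixes \<omega> :: "'n::finite \<Rightarrow> real"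
  assumes nz: "\<omega> i0 \<noteq> 0" and large: "real CARD('n) - 2 < \<bar>\<mu>\<bar>" and small: "\<bar>\<mu>\<bar> < real CARD('n)"
  obtains s x where "0 < s" "\<And>i. (x i)\<^sup>2 + (s * \<omega> i)\<^sup>2 = 1" "sum x UNIV = \<mu>"
proof -
  have *: "\<exists>s x. 0 < s \<and> (\<forall>i. (x i)\<^sup>2 + (s * \<omega> i)\<^sup>2 = 1) \<and> sum x UNIV = \<mu>"
    if \<mu>: "real CARD('n) - 2 < \<mu>" "\<mu> < real CARD('n)" for \<mu>
  proof -
    obtain m where m: "\<And>i. \<bar>\<omega> i\<bar> \<le> \<bar>\<omega> m\<bar>"
    proof -
      have "Max (range (\<lambda>i. \<bar>\<omega> i\<bar>)) \<in> range (\<lambda>i. \<bar>\<omega> i\<bar>)" by (rule Max_in) auto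
      then obtain m where "Max (range (\<lambda>i. \<bar>\<omega> i\<bar>)) = \<bar>\<omega> m\<bar>" by (rule imageE)
      moreover have "\<bar>\<omega> i\<bar> \<le> Max (range (\<lambda>i. \<bar>\<omega> i\<bar>))" for i by (rule Max_ge) auto
      ultimately show ?thesis using that by metis
    qed
    define M where "M = \<bar>\<omega> m\<bar>"
    have M: "0 < M" using m[of i0] nz by (simp add: M_def)
    have ratio: "(\<omega> i / M)\<^sup>2 \<le> 1" for i
      using m[of i] M by (simp add: abs_square_le_1 M_def)
    define X where "X \<theta> i = (if i = m then cos \<theta> else sqrt (1 - (sin \<theta> * (\<omega> i / M))\<^sup>2))" for \<theta> i
    have "(sin \<theta> * (\<omega> i / M))\<^sup>2 \<le> 1" for \<theta> i
    proof -
      have "(sin \<theta>)\<^sup>2 * (\<omega> i / M)\<^sup>2 \<le> 1 * 1"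
        by (rule mult_mono) (use ratio in \<open>auto simp: abs_square_le_1\<close>)
      then show ?thesis by (simp only: power_mult_distrib mult_1)
    qed
    then have X: "(X \<theta> i)\<^sup>2 + (sin \<theta> * (\<omega> i / M))\<^sup>2 = 1" for \<theta> i
    proof (cases "i = m")
      case True
      have "(\<omega> m / M)\<^sup>2 = 1" using M by (simp add: M_def power_divide)
      then show ?thesis unfolding True power_mult_distrib by (simp add: X_def)
    qed (simp add: X_def)
    define S where "S \<theta> = (\<Sum>i\<in>UNIV. X \<theta> i)" for \<theta>
    have S_eq: "S \<theta> = cos \<theta> + (\<Sum>i\<in>UNIV - {m}. sqrt (1 - (sin \<theta> * (\<omega> i / M))\<^sup>2))" for \<theta>
      unfolding S_def by (subst sum.remove[of _ m]) (auto simp: X_def intro!: sum.cong)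
    have card: "1 \<le> CARD('n)" by (simp add: Suc_leI)
    have ends: "S 0 = real CARD('n)" "S pi = real CARD('n) - 2"
      using card by (simp_all add: S_eq card_Diff_subset of_nat_diff)
    have "continuous_on {0..pi} S"
      unfolding S_eq[abs_def] by (intro continuous_intros)
    then obtain \<theta> where \<theta>: "0 \<le> \<theta>" "\<theta> \<le> pi" "S \<theta> = \<mu>"
      using IVT2'[of S pi \<mu> 0] ends \<mu> by auto
    have "\<theta> \<noteq> 0" "\<theta> \<noteq> pi" using \<theta> ends \<mu> by auto
    then have "0 < sin \<theta>" using \<theta> by (intro sin_gt_zero) auto
    then show ?thesis
      using M X[of \<theta>] \<theta>(3) by (intro exI[of _ "sin \<theta> / M"] exI[of _ "X \<theta>"]) (auto simp: S_def)
  qed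
  show ?thesis
  proof (cases "0 \<le> \<mu>")
    case True
    then show ?thesis using *[of \<mu>] large small that by auto
  next
    case False
    then obtain s x where "0 < s" "\<forall>i. (x i)\<^sup>2 + (s * \<omega> i)\<^sup>2 = 1" "sum x UNIV = - \<mu>"
      using *[of "- \<mu>"] large small by auto
    then show ?thesis using that[of s "\<lambda>i. - x i"] by (simp add: sum_negf)
  qed
qed

section \<open>The point of a level set with a given normal\<close>

lemma torus_grad_\<phi>:
  fixes y :: "real ^ 'n::finite"
  shows "torus_grad \<phi> (torus_of y) = (\<chi> i. - 2 * sin (y $ i))"
proof -
  have eq: "(\<lambda>x. \<phi> (torus_of y + torus_of x)) = (\<lambda>x::real^'n. 2 * (\<Sum>i\<in>UNIV. cos (y $ i + x $ i)))"
    by (simp add: plus_torus.abs_eq \<phi>.abs_eq)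
  have "((\<lambda>x::real^'n. 2 * (\<Sum>i\<in>UNIV. cos (y $ i + x $ i))) has_derivative
      (\<lambda>h. 2 * (\<Sum>i\<in>UNIV. - sin (y $ i) * h $ i))) (at 0)"
    by (auto intro!: derivative_eq_intros sum.cong bounded_linear.has_derivative[OF bounded_linear_vec_nth]
        simp: mult_ac)
  moreover have "(\<lambda>h. 2 * (\<Sum>i\<in>UNIV. - sin (y $ i) * h $ i)) = (\<lambda>h. h \<bullet> (\<chi> i. - 2 * sin (y $ i)))"
    by (simp add: inner_vec_def sum_distrib_left mult_ac)
  ultimately have d: "GDERIV (\<lambda>x. \<phi> (torus_of y + torus_of x)) 0 :> (\<chi> i. - 2 * sin (y $ i))"
    unfolding eq gderiv_def by simp
  show ?thesis unfolding torus_grad_def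
  proof (rule the_equality)
    show "GDERIV (\<lambda>x. \<phi> (torus_of y + torus_of x)) 0 :> (\<chi> i. - 2 * sin (y $ i))" by (rule d)
  next
    fix g assume "GDERIV (\<lambda>x. \<phi> (torus_of y + torus_of x)) 0 :> g"
    from has_derivative_unique[OF this[unfolded gderiv_def] d[unfolded gderiv_def]]
    have "h \<bullet> g = h \<bullet> (\<chi> i. - 2 * sin (y $ i))" for h by (rule fun_cong)
    then show "g = (\<chi> i. - 2 * sin (y $ i))" by (metis vector_eq_rdot inner_commute)
  qed
qed

lemma unit_normal_\<phi>_iff:
  fixes y \<omega> :: "real ^ 'n::finite"
  assumes "norm \<omega> = 1"
  shows "unit_normal \<phi> (torus_of y) = \<omega> \<longleftrightarrow> (\<exists>s>0. \<forall>i. sin (y $ i) = - (s * \<omega> $ i))"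
proof -
  define g where "g = torus_grad \<phi> (torus_of y)"
  have g: "g $ i = - 2 * sin (y $ i)" for i by (simp add: g_def torus_grad_\<phi>)
  show ?thesis unfolding unit_normal_def g_def[symmetric]
  proof
    assume u: "g /\<^sub>R norm g = \<omega>"
    then have ng: "norm g > 0" using assms by auto
    then have "g = norm g *\<^sub>R \<omega>" using u by auto
    then have "g $ i = norm g * \<omega> $ i" for i by (metis vector_scaleR_component real_scaleR_def)
    then have "sin (y $ i) = - (norm g / 2 * \<omega> $ i)" for i
      using g[of i] by simp
    then show "\<exists>s>0. \<forall>i. sin (y $ i) = - (s * \<omega> $ i)"
      using ng by (intro exI[of _ "norm g / 2"]) simp
  next
    assume "\<exists>s>0. \<forall>i. sin (y $ i) = - (s * \<omega> $ i)"
    then obtain s where s: "s > 0" "\<And>i. sin (y $ i) = - (s * \<omega> $ i)" by auto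
    then have "g = (2 * s) *\<^sub>R \<omega>" by (simp add: vec_eq_iff g)
    then show "g /\<^sub>R norm g = \<omega>" using assms s by simp
  qed
qed

text \<open>The amplitude samples the Fourier transform at the point \<open>\<kappa>\<close>, given by a definite description;
  only unique existence makes it known to lie on the level set. A point of the torus is determined
  by its sines and cosines, so this is unique solvability of the equations for the cosines.\<close>

lemma \<kappa>_in_level_set:
  fixes \<omega> :: "real ^ 'n::finite"
  assumes \<omega>: "norm \<omega> = 1"
    and lam: "2 * real CARD('n) - 4 < \<bar>lam\<bar>" "\<bar>lam\<bar> < 2 * real CARD('n)"
  shows "\<kappa> \<omega> lam \<in> \<Gamma> lam"
proof -
  have "\<exists>!k. k \<in> \<Gamma> lam \<and> unit_normal \<phi> k = \<omega>"
  proof (rule ex_ex1I)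
    obtain i0 where i0: "\<omega> $ i0 \<noteq> 0" using \<omega> by (metis norm_zero vec_eq_iff zero_index zero_neq_one)
    obtain s x where sx: "0 < s" "\<And>i. (x i)\<^sup>2 + (s * \<omega> $ i)\<^sup>2 = 1" "sum x UNIV = lam / 2"
      using normal_ray_cosines_exist[of "($) \<omega>" i0 "lam / 2"] i0 lam by auto
    have "\<exists>t. cos t = x i \<and> sin t = - (s * \<omega> $ i)" for i
      using sincos_total_2pi[of "x i" "- (s * \<omega> $ i)"] sx(2)[of i] by (metis power2_minus)
    then obtain t where t: "\<And>i. cos (t i) = x i" "\<And>i. sin (t i) = - (s * \<omega> $ i)" by metis
    have "torus_of (\<chi> i. t i) \<in> \<Gamma> lam"
      using sx(3) by (simp add: level_set_def \<phi>.abs_eq t)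
    moreover have "unit_normal \<phi> (torus_of (\<chi> i. t i)) = \<omega>"
      using sx(1) t(2) by (auto simp: unit_normal_\<phi>_iff[OF \<omega>])
    ultimately show "\<exists>k. k \<in> \<Gamma> lam \<and> unit_normal \<phi> k = \<omega>" by blast
  next
    fix k k' assume kk: "k \<in> \<Gamma> lam \<and> unit_normal \<phi> k = \<omega>" "k' \<in> \<Gamma> lam \<and> unit_normal \<phi> k' = \<omega>"
    have "\<exists>y. p = torus_of y" for p :: "'n torus" by (induct p rule: torus.abs_induct) blast
    then obtain y y' where y: "k = torus_of y" and y': "k' = torus_of y'" by metis
    obtain s where s: "s > 0" "\<And>i. sin (y $ i) = - (s * \<omega> $ i)"
      using kk(1) unfolding y unit_normal_\<phi>_iff[OF \<omega>] by blast
    obtain s' where s': "s' > 0" "\<And>i. sin (y' $ i) = - (s' * \<omega> $ i)"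
      using kk(2) unfolding y' unit_normal_\<phi>_iff[OF \<omega>] by blast
    have pyth: "(cos (z $ i))\<^sup>2 + r\<^sup>2 * (\<omega> $ i)\<^sup>2 = 1"
      if "\<And>i. sin (z $ i) = - (r * \<omega> $ i)" for z :: "real ^ 'n" and r i
      using sin_cos_squared_add2[of "z $ i"] unfolding that by (simp add: power_mult_distrib)
    have "(\<lambda>i. cos (y $ i)) = (\<lambda>i. cos (y' $ i))"
    proof (rule normal_ray_cosines_unique[where a = "s\<^sup>2" and b = "s'\<^sup>2" and w = "\<lambda>i. (\<omega> $ i)\<^sup>2" and \<mu> = "lam / 2"])
      show "(\<Sum>i\<in>UNIV. cos (y $ i)) = lam / 2" "(\<Sum>i\<in>UNIV. cos (y' $ i)) = lam / 2"
        using kk by (auto simp: y y' level_set_def \<phi>.abs_eq)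
    qed (use s s' pyth lam in auto)
    then have c: "cos (y $ i) = cos (y' $ i)" for i by (rule fun_cong)
    obtain i0 where i0: "\<omega> $ i0 \<noteq> 0" using \<omega> by (metis norm_zero vec_eq_iff zero_index zero_neq_one)
    have "s\<^sup>2 * (\<omega> $ i0)\<^sup>2 = s'\<^sup>2 * (\<omega> $ i0)\<^sup>2"
      using pyth[of y s i0, OF s(2)] pyth[of y' s' i0, OF s'(2)] unfolding c by linarith
    then have "s\<^sup>2 = s'\<^sup>2" using i0 by simp
    then have "s = s'" using s(1) s'(1) by simp
    then have "\<forall>i. \<exists>n::int. y $ i = y' $ i + 2 * pi * n"
      using s(2) s'(2) c by (auto simp: sin_cos_eq_iff[symmetric])
    then obtain n :: "'n \<Rightarrow> int" where "\<And>i. y $ i = y' $ i + 2 * pi * n i" by metis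
    then have "torus_rel y y'" unfolding torus_rel_def by (intro exI[of _ "\<chi> i. n i"]) simp
    then show "k = k'" by (simp add: y y' torus.abs_eq_iff)
  qed
  from theI'[OF this] show ?thesis unfolding \<kappa>_def by (rule conjunct1)
qed


section \<open>Orthogonality of the characters\<close>

lemma integral_lborel_prod_Basis:
  fixes g :: "'a::euclidean_space \<Rightarrow> real \<Rightarrow> 'b::{real_normed_field,banach,second_countable_topology}"
  assumes g: "\<And>b. b \<in> Basis \<Longrightarrow> integrable lborel (g b)"
  shows "(\<integral>y. (\<Prod>b\<in>Basis. g b (y \<bullet> b)) \<partial>(lborel :: 'a measure)) = (\<Prod>b\<in>Basis. \<integral>t. g b t \<partial>lborel)"
proof -
  interpret product_sigma_finite "\<lambda>_::'a. lborel :: real measure" ..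
  have [measurable]: "g b \<in> borel_measurable borel" if "b \<in> Basis" for b
    using g[OF that] by auto
  have "(\<integral>y. (\<Prod>b\<in>Basis. g b (y \<bullet> b)) \<partial>(lborel :: 'a measure))
      = (\<integral>f. (\<Prod>b\<in>Basis. g b ((\<Sum>b\<in>Basis. f b *\<^sub>R b) \<bullet> b)) \<partial>(\<Pi>\<^sub>M b\<in>Basis. lborel))"
    by (subst lborel_eq, rule integral_distr) measurable
  also have "\<dots> = (\<integral>f. (\<Prod>b\<in>Basis. g b (f b)) \<partial>(\<Pi>\<^sub>M b\<in>(Basis::'a set). lborel))"
    by (simp add: inner_sum_left_Basis)
  also have "\<dots> = (\<Prod>b\<in>Basis. \<integral>t. g b t \<partial>lborel)"
    by (rule product_integral_prod) (auto intro: g)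
  finally show ?thesis .
qed

lemma integrable_exp_Icc:
  "integrable lborel (\<lambda>t. indicator {- pi..pi} t *\<^sub>R exp (\<i> * of_real (t * r)))"
  by (rule borel_integrable_compact) (auto intro!: continuous_intros)

lemma integral_exp_period:
  "(\<integral>t. indicator {- pi..pi} t *\<^sub>R exp (\<i> * of_real (t * of_int n)) \<partial>lborel)
    = (if n = 0 then of_real (2 * pi) else 0)"
proof (cases "n = 0")
  case True
  then show ?thesis by (simp add: scaleR_conv_of_real)
next
  case False
  define F where "F t = exp (\<i> * of_real (t * of_int n)) / (\<i> * of_int n)" for t :: real
  have "(\<integral>t. indicator {- pi..pi} t *\<^sub>R exp (\<i> * of_real (t * of_int n)) \<partial>lborel) = F pi - F (- pi)"
  proof (rule integral_FTC_Icc)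
    fix t :: real
    have "((\<lambda>z. exp (\<i> * (z * of_int n)) / (\<i> * of_int n)) has_field_derivative
        exp (\<i> * (of_real t * of_int n))) (at (of_real t))"
      using False by (auto intro!: derivative_eq_intros simp: field_simps)
    from has_vector_derivative_real_field[OF this]
    show "(F has_vector_derivative exp (\<i> * of_real (t * of_int n))) (at t within {- pi..pi})"
      by (simp add: F_def[abs_def] o_def)
  qed (auto intro!: continuous_intros)
  also have "F pi = F (- pi)"
  proof -
    have "cis (pi * of_int n) = cis (- pi * of_int n) * cis (2 * pi * of_int n)"
      by (simp add: cis_mult algebra_simps)
    then have "cis (pi * of_int n) = cis (- pi * of_int n)"
      by (simp add: cis_multiple_2pi)
    then show ?thesis by (simp add: F_def cis_conv_exp)
  qed
  finally show ?thesis using False by simp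
qed

abbreviation cell :: "(real ^ 'n) set" where
  "cell \<equiv> cbox (\<chi> i. - pi) (\<chi> i. pi)"

lemma integrable_torus_char:
  "set_integrable lborel cell (\<lambda>y :: real ^ 'n::finite. torus_char x (torus_of y))"
  unfolding set_integrable_def torus_char.abs_eq
  by (rule borel_integrable_compact) (auto intro!: continuous_intros)

text \<open>Both the indicator of the cell and the character are products of functions of one coordinate,
  so the integral factors into one-dimensional integrals over a period.\<close>

lemma torus_integral_char:
  fixes x :: "int ^ 'n::finite"
  shows "torus_integral (torus_char x) = (if x = 0 then of_real ((2 * pi) ^ CARD('n)) else 0)"
proof -
  have all_zero: "(\<forall>b\<in>Basis. (\<chi> i. real_of_int (x $ i)) \<bullet> b = 0) \<longleftrightarrow> x = 0"
    by (auto simp: Basis_vec_def inner_axis vec_eq_iff)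
  have int: "\<exists>n::int. (\<chi> i. real_of_int (x $ i)) \<bullet> b = of_int n" if "b \<in> Basis" for b
    using that by (auto simp: Basis_vec_def inner_axis)
  define e where "e b t = indicator {- pi..pi} t *\<^sub>R exp (\<i> * of_real (t * ((\<chi> i. real_of_int (x $ i)) \<bullet> b)))"
    for b :: "real ^ 'n" and t
  have split: "indicator cell y *\<^sub>R torus_char x (torus_of y) = (\<Prod>b\<in>Basis. e b (y \<bullet> b))" for y
  proof -
    have "(\<Sum>i\<in>UNIV. y $ i * of_int (x $ i)) = y \<bullet> (\<chi> i. real_of_int (x $ i))"
      by (simp add: inner_vec_def)
    also have "\<dots> = (\<Sum>b\<in>Basis. (y \<bullet> b) * ((\<chi> i. real_of_int (x $ i)) \<bullet> b))"
      by (rule euclidean_inner)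
    finally have "torus_char x (torus_of y)
        = (\<Prod>b\<in>Basis. exp (\<i> * of_real ((y \<bullet> b) * ((\<chi> i. real_of_int (x $ i)) \<bullet> b))))"
      by (simp add: torus_char.abs_eq exp_sum sum_distrib_left)
    moreover have "(indicator cell y :: real) = (\<Prod>b\<in>Basis. indicator {- pi..pi} (y \<bullet> b))"
    proof -
      have "y \<in> cell \<longleftrightarrow> (\<forall>b\<in>Basis. y \<bullet> b \<in> {- pi..pi})"
        by (auto simp: mem_box Basis_vec_def inner_axis)
      then show ?thesis
        by (auto simp: indicator_def prod_zero_iff)
    qed
    ultimately show ?thesis by (simp add: e_def scaleR_conv_of_real prod.distrib)
  qed
  have "torus_integral (torus_char x) = (\<Prod>b\<in>Basis. \<integral>t. e b t \<partial>lborel)"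
    unfolding torus_integral_def set_lebesgue_integral_def split
    by (rule integral_lborel_prod_Basis) (unfold e_def, rule integrable_exp_Icc)
  also have "\<dots> = (\<Prod>b\<in>(Basis :: (real ^ 'n) set).
      if (\<chi> i. real_of_int (x $ i)) \<bullet> b = 0 then of_real (2 * pi) else 0)"
  proof (rule prod.cong)
    fix b :: "real ^ 'n" assume "b \<in> Basis"
    then obtain n :: int where "(\<chi> i. real_of_int (x $ i)) \<bullet> b = of_int n" using int by blast
    then show "(\<integral>t. e b t \<partial>lborel)
        = (if (\<chi> i. real_of_int (x $ i)) \<bullet> b = 0 then of_real (2 * pi) else 0)"
      by (simp add: e_def integral_exp_period[simplified])
  qed simp
  also have "\<dots> = (if x = 0 then of_real ((2 * pi) ^ CARD('n)) else 0)"
    using all_zero by (auto simp: prod_zero_iff)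
  finally show ?thesis .
qed

section \<open>Trigonometric polynomials and Fourier inversion\<close>

lemma torus_char_add: "torus_char (x + y) p = torus_char x p * torus_char y p"
  by transfer (simp add: exp_add[symmetric] ring_distribs sum.distrib)

lemma torus_char_shift: "torus_char x (p + q) = torus_char x p * torus_char x q"
  by transfer (simp add: exp_add[symmetric] ring_distribs sum.distrib)

text \<open>The dispersion relation is itself a trigonometric polynomial, being the symbol of the
  nearest-neighbour sum. Hence multiplying by \<open>\<phi>(p + q) - \<lambda>\<close> keeps the support of the inverse
  transform finite.\<close>

lemma \<phi>_eq_sum_char:
  "complex_of_real (\<phi> p) = (\<Sum>i\<in>UNIV. torus_char (axis i 1) p + torus_char (axis i (- 1)) p)"
proof (transfer, goal_cases)
  case (1 p)
  have ax: "(\<Sum>j\<in>UNIV. p $ j * of_int (axis i c $ j)) = p $ i * of_int c" for i and c :: int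
  proof -
    have "(\<Sum>j\<in>UNIV. p $ j * of_int (axis i c $ j)) = (\<Sum>j\<in>UNIV. if j = i then p $ i * of_int c else 0)"
      by (rule sum.cong) (auto simp: axis_def)
    then show ?thesis by simp
  qed
  have "2 * complex_of_real (cos (p $ i)) = exp (\<i> * of_real (p $ i)) + exp (- (\<i> * of_real (p $ i)))" for i
    by (simp add: cos_of_real[symmetric] cos_exp_eq)
  then show ?case by (simp add: ax sum_distrib_left)
qed

text \<open>Linear combinations of characters, generated by addition. Induction on this predicate avoids
  coefficient functions: multiplicativity and Fourier inversion only need checking on a single
  character and for sums.\<close>

inductive trig_poly :: "('n::finite torus \<Rightarrow> complex) \<Rightarrow> bool" where
  char: "trig_poly (\<lambda>p. a * torus_char x p)"
| add: "trig_poly f \<Longrightarrow> trig_poly g \<Longrightarrow> trig_poly (\<lambda>p. f p + g p)"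

lemma trig_poly_const: "trig_poly (\<lambda>p :: 'n::finite torus. c)"
proof -
  have "torus_char 0 p = 1" for p :: "'n torus" by transfer simp
  then show ?thesis using trig_poly.char[of c "0 :: int ^ 'n"] by simp
qed

lemma trig_poly_sum:
  assumes "\<And>i. i \<in> I \<Longrightarrow> trig_poly (f i)" shows "trig_poly (\<lambda>p. \<Sum>i\<in>I. f i p)"
  using assms by (induction I rule: infinite_finite_induct) (auto intro: trig_poly.add trig_poly_const)

lemma trig_poly_mult:
  assumes "trig_poly f" "trig_poly g" shows "trig_poly (\<lambda>p. f p * g p)"
  using assms(1)
proof induction
  case (char a x)
  show ?case using assms(2)
  proof induction
    case (char b y)
    have "(\<lambda>p. a * torus_char x p * (b * torus_char y p)) = (\<lambda>p. a * b * torus_char (x + y) p)"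
      by (simp add: torus_char_add mult_ac)
    then show ?case by (simp only: trig_poly.char)
  qed (simp add: distrib_left trig_poly.add)
qed (simp add: distrib_right trig_poly.add)

lemma trig_poly_prod:
  assumes "\<And>i. i \<in> I \<Longrightarrow> trig_poly (f i)" shows "trig_poly (\<lambda>p. \<Prod>i\<in>I. f i p)"
  using assms by (induction I rule: infinite_finite_induct) (auto intro: trig_poly_mult trig_poly_const)

lemma trig_poly_\<phi>_shift: "trig_poly (\<lambda>p. complex_of_real (\<phi> (p + q) - lam))"
proof -
  have "trig_poly (\<lambda>p. torus_char x (p + q))" for x :: "int ^ 'a"
    using trig_poly.char[of "torus_char x q" x] by (simp add: torus_char_shift mult.commute)
  then have "trig_poly (\<lambda>p. complex_of_real (\<phi> (p + q)) + (- of_real lam))"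
    unfolding \<phi>_eq_sum_char by (intro trig_poly.add trig_poly_sum trig_poly_const)
  then show ?thesis by simp
qed

lemma fourier_eq_sum:
  assumes "finite S" "\<And>x. x \<notin> S \<Longrightarrow> u x = 0"
  shows "fourier u k = of_real ((2 * pi) powr (- real CARD('n) / 2)) *
    (\<Sum>x\<in>S. u x * torus_char (- x) (k :: 'n::finite torus))"
proof -
  have "(\<Sum>\<^sub>\<infinity>x\<in>UNIV. u x * torus_char (- x) k) = (\<Sum>\<^sub>\<infinity>x\<in>S. u x * torus_char (- x) k)"
    by (rule infsum_cong_neutral) (use assms in auto)
  then show ?thesis using assms by (simp add: fourier_def)
qed

lemma trig_poly_fourier:
  assumes "finite {x. u x \<noteq> 0}" shows "trig_poly (fourier u)"
proof -
  have "fourier u = (\<lambda>k. of_real ((2 * pi) powr (- real CARD('a) / 2)) *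
    (\<Sum>x\<in>{x. u x \<noteq> 0}. u x * torus_char (- x) k))"
    by (rule ext, rule fourier_eq_sum[OF assms]) auto
  then show ?thesis
    by (auto intro!: trig_poly_mult trig_poly_const trig_poly_sum trig_poly.char)
qed

lemma fourier_add:
  assumes "finite {x. u x \<noteq> 0}" "finite {x. v x \<noteq> 0}"
  shows "fourier (\<lambda>x. u x + v x) p = fourier u p + fourier v p"
proof -
  define S where "S = {x. u x \<noteq> 0} \<union> {x. v x \<noteq> 0}"
  have S: "finite S" "\<And>x. x \<notin> S \<Longrightarrow> u x = 0" "\<And>x. x \<notin> S \<Longrightarrow> v x = 0"
    using assms by (auto simp: S_def)
  show ?thesis
    using S by (simp add: fourier_eq_sum[where S = S] ring_distribs sum.distrib)
qed

lemma inverse_fourier_char: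
  fixes x :: "int ^ 'n::finite"
  shows "inverse_fourier (\<lambda>p. a * torus_char x p)
    = (\<lambda>y. if y = - x then a * of_real ((2 * pi) powr (real CARD('n) / 2)) else 0)"
proof
  fix y
  have "torus_integral (\<lambda>p. a * torus_char x p * torus_char y p) = a * torus_integral (torus_char (x + y))"
    by (simp add: torus_integral_def torus_char_add mult.assoc)
  moreover have "x + y = 0 \<longleftrightarrow> y = - x" by (simp add: eq_neg_iff_add_eq_0 add.commute)
  moreover have "(2 * pi) powr (- real CARD('n) / 2) * (2 * pi) ^ CARD('n) = (2 * pi) powr (real CARD('n) / 2)"
    by (subst powr_realpow[symmetric]) (simp_all add: powr_add[symmetric])
  ultimately show "inverse_fourier (\<lambda>p. a * torus_char x p) y
      = (if y = - x then a * of_real ((2 * pi) powr (real CARD('n) / 2)) else 0)"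
    by (simp add: inverse_fourier_def torus_integral_char of_real_mult[symmetric] mult_ac del: of_real_mult)
qed

lemma integrable_trig_poly:
  assumes "trig_poly f"
  shows "set_integrable lborel cell (\<lambda>y. f (torus_of y))"
  using assms by induction (auto intro: integrable_torus_char)

lemma inverse_fourier_add:
  fixes f g :: "'n::finite torus \<Rightarrow> complex"
  assumes "trig_poly f" "trig_poly g"
  shows "inverse_fourier (\<lambda>p. f p + g p) = (\<lambda>x. inverse_fourier f x + inverse_fourier g x)"
proof
  fix x :: "int ^ 'n"
  have "set_integrable lborel cell (\<lambda>y. h (torus_of y) * torus_char x (torus_of y))" if "trig_poly h" for h :: "'n torus \<Rightarrow> complex"
    using integrable_trig_poly[OF trig_poly_mult[OF that trig_poly.char[of 1 x]]] by simp
  then show "inverse_fourier (\<lambda>p. f p + g p) x = inverse_fourier f x + inverse_fourier g x"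
    using assms by (simp add: inverse_fourier_def torus_integral_def ring_distribs)
qed

lemma fourier_inversion_trig_poly:
  fixes f :: "'n::finite torus \<Rightarrow> complex"
  assumes "trig_poly f"
  shows "finite {x. inverse_fourier f x \<noteq> 0} \<and> fourier (inverse_fourier f) = f"
  using assms
proof induction
  case (char a x)
  have "(2 * pi) powr (- real CARD('n) / 2) * (2 * pi) powr (real CARD('n) / 2) = 1"
    by (simp add: powr_add[symmetric])
  then have c: "complex_of_real ((2 * pi) powr (- real CARD('n) / 2)) * of_real ((2 * pi) powr (real CARD('n) / 2)) = 1"
    by (metis of_real_mult of_real_1)
  have "fourier (inverse_fourier (\<lambda>p. a * torus_char x p)) k = a * torus_char x k" for k
    using c by (subst fourier_eq_sum[where S = "{- x}"]) (auto simp: inverse_fourier_char)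
  then show ?case
    by (auto simp: inverse_fourier_char fun_eq_iff)
next
  case (add f g)
  have "{x. inverse_fourier f x + inverse_fourier g x \<noteq> 0}
      \<subseteq> {x. inverse_fourier f x \<noteq> 0} \<union> {x. inverse_fourier g x \<noteq> 0}" by auto
  with add show ?case
    by (auto simp: inverse_fourier_add fourier_add fun_eq_iff intro: finite_subset)
qed


section \<open>Vanishing of the Born amplitude\<close>

theorem theoremA7:
  fixes u v :: "int ^ 'n::finite \<Rightarrow> complex"
    and lam :: real and J :: nat and k :: "nat \<Rightarrow> 'n torus"
  assumes "finite {x. u x \<noteq> 0}"
    and "2 * real CARD('n) - 4 < \<bar>lam\<bar>" and "\<bar>lam\<bar> < 2 * real CARD('n)"
    and "J \<ge> 1" and "\<And>j. j \<in> {1..J} \<Longrightarrow> k j \<in> \<Gamma> lam"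
    and "v = inverse_fourier
               (\<lambda>p. fourier u p * (\<Prod>j\<in>{1..J}. complex_of_real (\<phi> (p + k j) - lam)))"
  shows "finite {x. v x \<noteq> 0} \<and>
         (\<forall>j\<in>{1..J}. \<forall>\<omega>\<in>sphere 0 1. born_amplitude v lam (k j) \<omega> = 0)"
proof -
  define W where "W p = fourier u p * (\<Prod>j\<in>{1..J}. complex_of_real (\<phi> (p + k j) - lam))" for p
  have v: "v = inverse_fourier W" using assms(6) by (simp add: W_def[abs_def])
  have "trig_poly W"
    unfolding W_def[abs_def]
    by (intro trig_poly_mult trig_poly_fourier[OF assms(1)] trig_poly_prod trig_poly_\<phi>_shift)
  then have fin: "finite {x. v x \<noteq> 0}" and hat: "fourier v = W"
    using fourier_inversion_trig_poly by (auto simp: v)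
  have "born_amplitude v lam (k j) \<omega> = 0" if j: "j \<in> {1..J}" and \<omega>: "\<omega> \<in> sphere 0 1" for j \<omega>
  proof -
    have "\<kappa> (- \<omega>) lam \<in> \<Gamma> lam"
      using \<omega> assms(2,3) by (intro \<kappa>_in_level_set) auto
    then have "\<phi> (\<kappa> (- \<omega>) lam - k j + k j) - lam = 0"
      by (simp add: level_set_def)
    then have "(\<Prod>i\<in>{1..J}. complex_of_real (\<phi> (\<kappa> (- \<omega>) lam - k j + k i) - lam)) = 0"
      using j by (intro prod_zero) (auto intro!: bexI[of _ j])
    then have "W (\<kappa> (- \<omega>) lam - k j) = 0" by (simp add: W_def)
    then show ?thesis by (simp add: born_amplitude_def hat)
  qed
  with fin show ?thesis by blast
qed

end
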